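(* Let $p,q$ be integers with $q\ge 1$. Then there exist real coefficients $a_0,\dots,a_{2q-1}$ and $b_0,\dots,b_{2q-1}$, depending only on $p$ and $q$, such that for every integrable $2\pi$-periodic initial datum $f$, the solution $u(t,x)$ of the periodic initial value problem on $-\pi<x<\pi$ for the linearised Benjamin--Ono equation $$u_t=\mathcal H[u_{xx}],\qquad u(0,x)=f(x),$$ satisfies, at the rational time $t=\pi p/q$, $$u\left(\frac{\pi p}{q},x\right)=\sum_{j=0}^{2q-1}a_j\,f\left(x+\frac{\pi j}{q}\right)+\sum_{j=0}^{2q-1}b_j\,g\left(x+\frac{\pi j}{q}\right),\qquad g=\mathcal H[f].$$ That is, the solution is a linear combination of translates of the initial condition and of translates of its periodic Hilbert transform. The equality is understood in the sense of $2\pi$-periodic distributions, equivalently as equality of all Fourier coefficients.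
   Context: All functions and distributions on $(-\pi,\pi)$ are extended $2\pi$-periodically to $\mathbb R$. The periodic (circular) Hilbert transform is the principal value integral $$\mathcal H[f](x)=\frac1{2\pi}\,\mathrm{p.v.}\!\int_{-\pi}^{\pi}\cot\left(\tfrac12(x-y)\right)f(y)\,dy .$$ Equivalently, it is the Fourier multiplier sending $e^{ikx}$ to $-i\,\mathrm{sgn}(k)\,e^{ikx}$ for $k\in\mathbb Z$, with $\mathrm{sgn}(0)=0$; in this form it is defined on all $2\pi$-periodic distributions. The solution of the periodic initial value problem is understood mode by mode through its Fourier series: if $f\sim\sum_k c_k e^{ikx}$, then $u(t,\cdot)$ is the $2\pi$-periodic distribution whose Fourier coefficients solve the ordinary differential equations obtained by applying the equation to each mode $e^{ikx}$, with initial values $c_k$. *)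

theory Defs
  imports "HOL-Analysis.Analysis"
begin

definition periodic_2pi :: "(real \<Rightarrow> complex) \<Rightarrow> bool" where
  "periodic_2pi f \<longleftrightarrow> (\<forall>x. f (x + 2 * pi) = f x)"

definition vderiv :: "(real \<Rightarrow> complex) \<Rightarrow> real \<Rightarrow> complex" where
  "vderiv f = (\<lambda>x. vector_derivative f (at x))"

definition test_function :: "(real \<Rightarrow> complex) \<Rightarrow> bool" where
  "test_function \<phi> \<longleftrightarrow> periodic_2pi \<phi> \<and> (\<forall>n x. (vderiv ^^ n) \<phi> differentiable (at x))"

text \<open>A periodic distribution is a functional that is linear and continuous on the smooth
  periodic functions. Values on other arguments are irrelevant, so equality of distributions
  is \<open>pdist_eq\<close>, not equality of functionals.\<close>

type_synonym functional = "(real \<Rightarrow> complex) \<Rightarrow> complex"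

definition periodic_distribution :: "functional \<Rightarrow> bool" where
  "periodic_distribution T \<longleftrightarrow>
     (\<forall>\<phi> \<psi>. test_function \<phi> \<longrightarrow> test_function \<psi> \<longrightarrow> T (\<lambda>x. \<phi> x + \<psi> x) = T \<phi> + T \<psi>) \<and>
     (\<forall>c \<phi>. test_function \<phi> \<longrightarrow> T (\<lambda>x. c * \<phi> x) = c * T \<phi>) \<and>
     (\<exists>N C. \<forall>\<phi>. test_function \<phi> \<longrightarrow>
        norm (T \<phi>) \<le> C * (\<Sum>n\<le>N. SUP x\<in>{-pi..pi}. norm ((vderiv ^^ n) \<phi> x)))"

definition pdist_eq :: "functional \<Rightarrow> functional \<Rightarrow> bool" where
  "pdist_eq S T \<longleftrightarrow> (\<forall>\<phi>. test_function \<phi> \<longrightarrow> S \<phi> = T \<phi>)"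

definition pdist_of :: "(real \<Rightarrow> complex) \<Rightarrow> functional" where
  "pdist_of f = (\<lambda>\<phi>. integral {-pi..pi} (\<lambda>x. f x * \<phi> x))"

definition pdist_deriv :: "functional \<Rightarrow> functional" where
  "pdist_deriv T = (\<lambda>\<phi>. - T (vderiv \<phi>))"

text \<open>Translation sends \<open>T(x)\<close> to \<open>T(x + h)\<close>, hence the opposite shift of the test function.\<close>

definition pdist_translate :: "real \<Rightarrow> functional \<Rightarrow> functional" where
  "pdist_translate h T = (\<lambda>\<phi>. T (\<lambda>x. \<phi> (x - h)))"

definition fourier_coeff :: "functional \<Rightarrow> int \<Rightarrow> complex" where
  "fourier_coeff T k = T (\<lambda>x. cis (- (of_int k * x))) / (2 * of_real pi)"

text \<open>The sum of the series of \<open>c k * exp (i k x)\<close> in the sense of periodic distributions.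
  For \<open>c\<close> of polynomial growth it converges absolutely on every test function.\<close>

definition fourier_series :: "(int \<Rightarrow> complex) \<Rightarrow> functional" where
  "fourier_series c = (\<lambda>\<phi>. \<Sum>\<^sub>\<infinity>k. c k * pdist_of (\<lambda>x. cis (of_int k * x)) \<phi>)"

text \<open>The periodic Hilbert transform in its Fourier multiplier form. The Hilbert transform of an
  integrable function need not be integrable, so it is taken as a distribution throughout.\<close>

definition hilbert :: "functional \<Rightarrow> functional" where
  "hilbert T = fourier_series (\<lambda>k. - \<i> * of_int (sgn k) * fourier_coeff T k)"

lemma integral_cis_mode:
  "integral {-pi..pi} (\<lambda>x. cis (of_int m * x)) = (if m = 0 then 2 * of_real pi else 0)"
proof (cases "m = 0")
  case True
  then show ?thesis by (simp add: scaleR_conv_of_real)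
next
  case False
  define F where "F x = cis (of_int m * x) / (\<i> * of_int m)" for x :: real
  have "((\<lambda>x. cis (of_int m * x)) has_integral (F pi - F (-pi))) {-pi..pi}"
  proof (rule fundamental_theorem_of_calculus)
    fix x :: real
    show "(F has_vector_derivative cis (of_int m * x)) (at x within {-pi..pi})"
      unfolding F_def has_vector_derivative_def using False
      by (auto intro!: derivative_eq_intros simp: fun_eq_iff scaleR_conv_of_real field_simps)
  qed auto
  moreover have "F pi = F (-pi)"
  proof -
    have "cis (of_int m * pi) = cis (of_int m * (-pi)) * cis (2 * pi * of_int m)"
      by (simp add: cis_mult algebra_simps)
    also have "cis (2 * pi * of_int m) = 1"
      by (rule cis_multiple_2pi) auto
    finally show ?thesis by (simp add: F_def)
  qed
  ultimately show ?thesis using False by (simp add: integral_unique)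
qed

lemma fourier_coeff_fourier_series: "fourier_coeff (fourier_series c) k = c k"
proof -
  have *: "pdist_of (\<lambda>x. cis (of_int n * x)) (\<lambda>x. cis (- (of_int k * x))) =
        (if n = k then 2 * of_real pi else 0)" for n
    using integral_cis_mode[of "n - k"]
    by (simp add: pdist_of_def cis_mult algebra_simps)
  have "fourier_series c (\<lambda>x. cis (- (of_int k * x))) =
      (\<Sum>\<^sub>\<infinity>n\<in>{k}. c n * (if n = k then 2 * of_real pi else 0))"
    unfolding fourier_series_def * by (rule infsum_cong_neutral) auto
  then show ?thesis by (simp add: fourier_coeff_def)
qed

lemma fourier_coeff_hilbert:
  "fourier_coeff (hilbert T) k = - \<i> * of_int (sgn k) * fourier_coeff T k"
  by (simp add: hilbert_def fourier_coeff_fourier_series)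

text \<open>\<open>u\<close> solves \<open>u_t = H[u_xx]\<close>, \<open>u(0) = f\<close>, mode by mode. The time variable ranges
  over all reals because the time of interest may be negative.\<close>

definition BO_solution :: "(real \<Rightarrow> complex) \<Rightarrow> (real \<Rightarrow> functional) \<Rightarrow> bool" where
  "BO_solution f u \<longleftrightarrow>
     (\<forall>t. periodic_distribution (u t)) \<and>
     (\<forall>k. fourier_coeff (u 0) k = fourier_coeff (pdist_of f) k) \<and>
     (\<forall>k t. ((\<lambda>s. fourier_coeff (u s) k) has_vector_derivative
               fourier_coeff (hilbert (pdist_deriv (pdist_deriv (u t)))) k) (at t))"

end

theory Submission
  imports Defs
begin

text \<open>On the mode \<open>exp (i k x)\<close> the equation reads \<open>c' = i k |k| c\<close>. At the time
  \<open>\<pi> p / q\<close> the solution therefore multiplies the \<open>k\<close>-th coefficient by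
  \<open>exp (i \<pi> p k |k| / q) = cos (\<theta> k) - (- i sgn k) sin (\<theta> k)\<close> with \<open>\<theta> k = \<pi> p k\<^sup>2 / q\<close>.
  Both \<open>cos (\<theta> k)\<close> and \<open>sin (\<theta> k)\<close> are real, even and \<open>2 q\<close>-periodic in \<open>k\<close>, so
  discrete Fourier inversion writes each as a real combination of the characters
  \<open>exp (i k \<pi> j / q)\<close>, the multipliers of translation by \<open>\<pi> j / q\<close>; the factor
  \<open>- i sgn k\<close> is the multiplier of the Hilbert transform.

  Equality of Fourier coefficients gives equality of distributions because the Fourier series of
  a test function converges to it uniformly with all derivatives: the coefficients decay
  rapidly, and the pointwise limit is identified by a telescoping argument that needs only
  the Riemann--Lebesgue lemma for continuous functions.\<close>

section \<open>Characters and integrals over a period\<close>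

definition mode :: "int \<Rightarrow> real \<Rightarrow> complex" where
  "mode k x = cis (of_int k * x)"

lemma norm_mode [simp]: "norm (mode k x) = 1"
  by (simp add: mode_def)

lemma mode_0 [simp]: "mode k 0 = 1" "mode 0 x = 1"
  by (simp_all add: mode_def)

lemma mode_mult: "mode k x * mode l x = mode (k + l) x"
  by (simp add: mode_def cis_mult algebra_simps)

lemma mode_add: "mode k (x + y) = mode k x * mode k y"
  by (simp add: mode_def cis_mult algebra_simps)

lemma cnj_mode: "cnj (mode k x) = mode (- k) x"
  by (simp add: mode_def cis_cnj)

lemma has_vector_derivative_mode:
  "(mode k has_vector_derivative \<i> * of_int k * mode k x) (at x)"
  unfolding mode_def has_vector_derivative_def
  by (auto intro!: derivative_eq_intros simp: fun_eq_iff scaleR_conv_of_real field_simps)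

lemma continuous_on_mode [continuous_intros]: "continuous_on A (mode k)"
  by (meson continuous_at_imp_continuous_on differentiable_imp_continuous_within
      has_vector_derivative_mode differentiableI_vector)

lemma periodic_mode: "periodic_2pi (mode k)"
proof -
  have "cis (2 * pi * of_int k) = 1" by (rule cis_multiple_2pi) auto
  then show ?thesis
    by (simp add: periodic_2pi_def mode_def ring_distribs mult_ac flip: cis_mult)
qed

lemma integral_mode: "integral {-pi..pi} (mode k) = (if k = 0 then 2 * of_real pi else 0)"
  using integral_cis_mode[of k] by (simp add: mode_def[abs_def])

lemma fourier_coeff_mode: "fourier_coeff T k = T (mode (- k)) / (2 * of_real pi)"
  by (simp add: fourier_coeff_def mode_def[abs_def])

lemma periodic_2pi_int:
  assumes "periodic_2pi f"
  shows "f (x + 2 * pi * of_int n) = f x"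
proof (induction n rule: int_induct[where k = 0])
  case (step1 i)
  have "f (x + 2 * pi * of_int i + 2 * pi) = f (x + 2 * pi * of_int i)"
    using assms unfolding periodic_2pi_def by blast
  with step1 show ?case by (simp add: algebra_simps)
next
  case (step2 i)
  have "f (x + 2 * pi * of_int (i - 1) + 2 * pi) = f (x + 2 * pi * of_int (i - 1))"
    using assms unfolding periodic_2pi_def by blast
  with step2 show ?case by (simp add: algebra_simps)
qed simp

lemma periodic_2pi_translate: "periodic_2pi f \<Longrightarrow> periodic_2pi (\<lambda>x. f (x + h))"
  unfolding periodic_2pi_def by (metis add.assoc add.commute)

lemma has_integral_periodic_shift:
  assumes f: "periodic_2pi f" and I: "(f has_integral I) {-pi..pi}"
  shows "((\<lambda>x. f (x + h)) has_integral I) {-pi..pi}"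
proof -
  \<comment> \<open>\<open>n\<close> counts the whole periods in \<open>h\<close>; the remainder
    \<open>h'\<close> lies in [0, 2 pi], so the shifted window reaches into one further period
    only.\<close>
  define n where "n = \<lfloor>h / (2 * pi)\<rfloor>"
  define h' where "h' = h - 2 * pi * of_int n"
  have h': "0 \<le> h'" "h' \<le> 2 * pi"
    using floor_correct[of "h / (2 * pi)"] pi_gt_zero unfolding n_def[symmetric]
    by (simp_all add: h'_def field_simps)
  have fh: "f (x + h) = f (h' + x)" for x
    using periodic_2pi_int[OF f, of "h' + x" n] by (simp add: h'_def algebra_simps)
  have int: "f integrable_on {-pi..pi}" using I by blast
  obtain I1 I2 where I1: "(f has_integral I1) {-pi..-pi + h'}" and I2: "(f has_integral I2) {-pi + h'..pi}"
    using integrable_subinterval_real[OF int, of "-pi" "-pi + h'"]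
      integrable_subinterval_real[OF int, of "-pi + h'" pi] h'
    unfolding integrable_on_def by auto
  have "(f has_integral I1 + I2) {-pi..pi}"
    using has_integral_combine[OF _ _ I1 I2] h' by simp
  then have I12: "I1 + I2 = I"
    using I has_integral_unique by blast
  \<comment> \<open>The piece to the left of \<open>-pi + h'\<close> moves by one period to the
    right end; the two pieces then cover the shifted window.\<close>
  have "((f \<circ> (+) (2 * pi)) has_integral I1) {-pi..-pi + h'}"
    using I1 f by (simp add: o_def periodic_2pi_def add.commute)
  then have "(f has_integral I1) {pi..pi + h'}"
    by (subst (asm) has_integral_shift_Icc_real) (simp add: algebra_simps)
  then have "(f has_integral I2 + I1) {-pi + h'..pi + h'}"
    using has_integral_combine[OF _ _ I2] h' by simp
  then show ?thesis
    using has_integral_shift_Icc_real[of f h' I "-pi" pi] I12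
    by (simp add: fh o_def add.commute)
qed

text \<open>Integrability passes to the translate and, by shifting back, from it; in the
  nonintegrable case both integrals take the default value 0.\<close>

lemma integral_periodic_shift:
  assumes "periodic_2pi f"
  shows "integral {-pi..pi} (\<lambda>x. f (x + h)) = integral {-pi..pi} f"
proof (cases "f integrable_on {-pi..pi}")
  case True
  then show ?thesis
    using has_integral_periodic_shift[OF assms] by (blast intro: integral_unique)
next
  case False
  have "periodic_2pi (\<lambda>x. f (x + h))"
    by (rule periodic_2pi_translate) (fact assms)
  from has_integral_periodic_shift[OF this, of _ "-h"] False
  have "\<not> (\<lambda>x. f (x + h)) integrable_on {-pi..pi}"
    by (auto simp: integrable_on_def)
  with False show ?thesis by (simp add: not_integrable_integral)
qed

section \<open>Smooth periodic test functions\<close>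

lemma periodic_2pi_vderiv:
  assumes "periodic_2pi \<phi>"
  shows "periodic_2pi (vderiv \<phi>)"
proof -
  \<comment> \<open>The same values \<open>D\<close> are derivatives at \<open>x\<close> and at
    \<open>x + 2 * pi\<close>, so the choice behind \<open>vector_derivative\<close> agrees at both
    points, even where no derivative exists.\<close>
  have "(\<phi> has_vector_derivative D) (at (x + 2 * pi)) \<longleftrightarrow> (\<phi> has_vector_derivative D) (at x)" for D x
  proof -
    have "(\<lambda>y. \<phi> (y + 2 * pi)) = \<phi>" using assms by (auto simp: periodic_2pi_def)
    moreover have "(\<phi> has_vector_derivative D) (at (x + 2 * pi)) \<longleftrightarrow>
        ((\<lambda>y. \<phi> (y + 2 * pi)) has_vector_derivative D) (at x)"
      unfolding has_vector_derivative_def has_derivative_at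
      by (simp add: algebra_simps)
    ultimately show ?thesis by simp
  qed
  then show ?thesis by (simp add: periodic_2pi_def vderiv_def vector_derivative_def)
qed

text \<open>An explicit sequence \<open>D\<close> of successive derivatives proves smoothness and at
  the same time identifies the iterates of \<open>vderiv\<close>, by induction on the order. Sums,
  multiples, translates and characters are all handled through such a sequence.\<close>

lemma
  assumes "periodic_2pi \<phi>" "D 0 = \<phi>" "\<And>n x. (D n has_vector_derivative D (Suc n) x) (at x)"
  shows test_functionI: "test_function \<phi>"
    and vderiv_funpow_eqI: "(vderiv ^^ n) \<phi> = D n"
proof -
  have D: "(vderiv ^^ n) \<phi> = D n" for n
  proof (induction n)
    case (Suc n)
    then have "(vderiv ^^ Suc n) \<phi> = vderiv (D n)" by simp
    also have "\<dots> = D (Suc n)"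
      using assms(3) by (simp add: vderiv_def vector_derivative_at fun_eq_iff)
    finally show ?case .
  qed (simp add: assms)
  show "test_function \<phi>"
    using assms(1,3) by (auto simp: test_function_def D intro: differentiableI_vector)
  show "(vderiv ^^ n) \<phi> = D n" by (fact D)
qed

lemma test_function_has_vderiv:
  assumes "test_function \<phi>"
  shows "((vderiv ^^ n) \<phi> has_vector_derivative (vderiv ^^ Suc n) \<phi> x) (at x)"
  using assms by (simp add: test_function_def vderiv_def vector_derivative_works[symmetric])

lemma test_function_vderiv: "test_function \<phi> \<Longrightarrow> test_function (vderiv \<phi>)"
  using periodic_2pi_vderiv[of \<phi>] funpow_simps_right(2)[of _ vderiv]
  unfolding test_function_def by (metis o_apply)

lemma test_function_vderiv_funpow: "test_function \<phi> \<Longrightarrow> test_function ((vderiv ^^ n) \<phi>)"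
  by (induction n) (auto intro: test_function_vderiv)

lemma test_function_continuous: "test_function \<phi> \<Longrightarrow> continuous_on A \<phi>"
  using test_function_has_vderiv[of \<phi> 0]
  by (auto intro!: continuous_at_imp_continuous_on intro: has_vector_derivative_continuous)

lemma
  assumes "test_function \<phi>" "test_function \<psi>"
  shows test_function_add: "test_function (\<lambda>x. \<phi> x + \<psi> x)"
    and vderiv_funpow_add:
      "(vderiv ^^ n) (\<lambda>x. \<phi> x + \<psi> x) = (\<lambda>x. (vderiv ^^ n) \<phi> x + (vderiv ^^ n) \<psi> x)"
proof -
  have *: "periodic_2pi (\<lambda>x. \<phi> x + \<psi> x)"
    using assms by (simp add: test_function_def periodic_2pi_def)
  have D: "((\<lambda>x. (vderiv ^^ n) \<phi> x + (vderiv ^^ n) \<psi> x) has_vector_derivative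
      (vderiv ^^ Suc n) \<phi> x + (vderiv ^^ Suc n) \<psi> x) (at x)" for n x
    by (intro has_vector_derivative_add test_function_has_vderiv assms)
  let ?D = "\<lambda>n x. (vderiv ^^ n) \<phi> x + (vderiv ^^ n) \<psi> x"
  show "test_function (\<lambda>x. \<phi> x + \<psi> x)"
      "(vderiv ^^ n) (\<lambda>x. \<phi> x + \<psi> x) = (\<lambda>x. (vderiv ^^ n) \<phi> x + (vderiv ^^ n) \<psi> x)"
    by (rule test_functionI[where D = ?D] vderiv_funpow_eqI[where D = ?D], fact *, simp, rule D)+
qed

lemma
  assumes "test_function \<phi>"
  shows test_function_cmult: "test_function (\<lambda>x. c * \<phi> x)"
    and vderiv_funpow_cmult: "(vderiv ^^ n) (\<lambda>x. c * \<phi> x) = (\<lambda>x. c * (vderiv ^^ n) \<phi> x)"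
proof -
  have *: "periodic_2pi (\<lambda>x. c * \<phi> x)"
    using assms by (simp add: test_function_def periodic_2pi_def)
  have D: "((\<lambda>x. c * (vderiv ^^ n) \<phi> x) has_vector_derivative c * (vderiv ^^ Suc n) \<phi> x) (at x)" for n x
    by (intro has_vector_derivative_mult_right test_function_has_vderiv assms)
  let ?D = "\<lambda>n x. c * (vderiv ^^ n) \<phi> x"
  show "test_function (\<lambda>x. c * \<phi> x)"
      "(vderiv ^^ n) (\<lambda>x. c * \<phi> x) = (\<lambda>x. c * (vderiv ^^ n) \<phi> x)"
    by (rule test_functionI[where D = ?D] vderiv_funpow_eqI[where D = ?D], fact *, simp, rule D)+
qed

lemma test_function_translate:
  assumes "test_function \<phi>"
  shows "test_function (\<lambda>x. \<phi> (x + h))"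
proof (rule test_functionI[where D = "\<lambda>n x. (vderiv ^^ n) \<phi> (x + h)"])
  show "periodic_2pi (\<lambda>x. \<phi> (x + h))"
    using assms by (simp add: test_function_def periodic_2pi_translate)
  show "((\<lambda>x. (vderiv ^^ n) \<phi> (x + h)) has_vector_derivative (vderiv ^^ Suc n) \<phi> (x + h)) (at x)" for n x
    using test_function_has_vderiv[OF assms, of n "x + h"]
    unfolding has_vector_derivative_def has_derivative_at by (simp add: algebra_simps)
qed simp

lemma
  shows test_function_mode: "test_function (mode k)"
    and vderiv_funpow_mode: "(vderiv ^^ n) (mode k) = (\<lambda>x. (\<i> * of_int k) ^ n * mode k x)"
proof -
  have D: "((\<lambda>x. (\<i> * of_int k) ^ n * mode k x) has_vector_derivative
      (\<i> * of_int k) ^ Suc n * mode k x) (at x)" for n x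
    using has_vector_derivative_mult_right[OF has_vector_derivative_mode[of k x], of "(\<i> * of_int k) ^ n"]
    by (simp add: mult_ac)
  let ?D = "\<lambda>n x. (\<i> * of_int k) ^ n * mode k x"
  show "test_function (mode k)" "(vderiv ^^ n) (mode k) = (\<lambda>x. (\<i> * of_int k) ^ n * mode k x)"
    by (rule test_functionI[where D = ?D] vderiv_funpow_eqI[where D = ?D], rule periodic_mode, simp, rule D)+
qed

text \<open>\<open>T\<close> is known to be linear only on test functions, so the induction on
  \<open>F\<close> carries the smoothness of the partial sums along with linearity.\<close>

lemma
  assumes "finite F"
  shows test_function_sum_mode: "test_function (\<lambda>x. \<Sum>k\<in>F. c k * mode (g k) x)" (is ?A)
    and vderiv_funpow_sum_mode: "(vderiv ^^ n) (\<lambda>x. \<Sum>k\<in>F. c k * mode (g k) x) =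
      (\<lambda>x. \<Sum>k\<in>F. c k * (\<i> * of_int (g k)) ^ n * mode (g k) x)" (is ?B)
    and periodic_distribution_sum_mode: "periodic_distribution T \<Longrightarrow>
      T (\<lambda>x. \<Sum>k\<in>F. c k * mode (g k) x) = (\<Sum>k\<in>F. c k * T (mode (g k)))" (is "?P \<Longrightarrow> ?C")
proof -
  \<comment> \<open>The zero function is treated as 0 times a character, which makes it a test
    function.\<close>
  have 0: "test_function (\<lambda>x. 0)" "(vderiv ^^ n) (\<lambda>x. 0) = (\<lambda>x. 0)"
    using test_function_cmult[OF test_function_mode, of 0 0]
      vderiv_funpow_cmult[OF test_function_mode, of n 0 0] by simp_all
  have "?A \<and> ?B \<and> (?P \<longrightarrow> ?C)"
    using assms
  proof (induction F)
    case empty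
    have "T (\<lambda>x. 0 * 0) = 0 * T (\<lambda>x. 0)" if ?P
      using that 0 unfolding periodic_distribution_def by blast
    then show ?case using 0 by simp
  next
    case (insert k F)
    have A: "test_function (\<lambda>x. c k * mode (g k) x)"
      by (intro test_function_cmult test_function_mode)
    have "T (\<lambda>x. c k * mode (g k) x + (\<Sum>k\<in>F. c k * mode (g k) x)) =
        c k * T (mode (g k)) + (\<Sum>k\<in>F. c k * T (mode (g k)))" if ?P
    proof -
      have "T (\<lambda>x. c k * mode (g k) x + (\<Sum>k\<in>F. c k * mode (g k) x)) =
          T (\<lambda>x. c k * mode (g k) x) + T (\<lambda>x. \<Sum>k\<in>F. c k * mode (g k) x)"
        using insert.IH that A unfolding periodic_distribution_def by blast
      moreover have "T (\<lambda>x. c k * mode (g k) x) = c k * T (mode (g k))"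
        using test_function_mode that unfolding periodic_distribution_def by blast
      ultimately show ?thesis using insert.IH that by simp
    qed
    then show ?case
      using insert test_function_add[OF A, of "\<lambda>x. \<Sum>k\<in>F. c k * mode (g k) x"]
        vderiv_funpow_add[OF A, of "\<lambda>x. \<Sum>k\<in>F. c k * mode (g k) x" n]
      by (simp add: vderiv_funpow_cmult[OF test_function_mode] vderiv_funpow_mode mult.assoc)
  qed
  then show ?A ?B "?P \<Longrightarrow> ?C" by blast+
qed

lemma test_function_bdd_above: "test_function \<phi> \<Longrightarrow> bdd_above ((\<lambda>x. norm (\<phi> x)) ` {-pi..pi})"
  by (intro bounded_imp_bdd_above compact_imp_bounded compact_continuous_image continuous_intros
      test_function_continuous) auto

section \<open>Bessel's inequality and the Riemann-Lebesgue lemma\<close>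

lemma fcoeff_eq:
  "fourier_coeff (pdist_of g) k = integral {-pi..pi} (\<lambda>x. g x * mode (- k) x) / (2 * of_real pi)"
  by (simp add: fourier_coeff_mode pdist_of_def)

text \<open>Conjugation is bounded and linear, hence commutes with the integral; it also preserves
  nonintegrability, where both sides are the default 0.\<close>

lemma cnj_integral: "cnj (integral A f) = integral A (\<lambda>x. cnj (f x))"
proof (cases "f integrable_on A")
  case True
  then show ?thesis using integral_linear[OF True bounded_linear_cnj] by (simp add: o_def)
next
  case False
  then have "\<not> (\<lambda>x. cnj (f x)) integrable_on A"
    using integrable_linear[OF _ bounded_linear_cnj, of "\<lambda>x. cnj (f x)" A] by (auto simp: o_def)
  with False show ?thesis by (simp add: not_integrable_integral)
qed

lemma integral_mult_cnj_self:
  fixes h :: "real \<Rightarrow> complex"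
  assumes "continuous_on {-pi..pi} h"
  shows "integral {-pi..pi} (\<lambda>x. h x * cnj (h x)) = of_real (integral {-pi..pi} (\<lambda>x. (norm (h x))\<^sup>2))"
proof -
  have int: "(\<lambda>x. (norm (h x))\<^sup>2) integrable_on {-pi..pi}"
    by (intro integrable_continuous_interval continuous_intros assms)
  have "integral {-pi..pi} (complex_of_real \<circ> (\<lambda>x. (norm (h x))\<^sup>2)) =
      of_real (integral {-pi..pi} (\<lambda>x. (norm (h x))\<^sup>2))"
    by (rule integral_linear[OF int bounded_linear_of_real])
  then show ?thesis by (simp only: o_def complex_norm_square)
qed

text \<open>The partial sum \<open>s\<close> is the orthogonal projection of \<open>g\<close> onto
  the span of the characters in \<open>F\<close>. By Pythagoras the squared norm of
  \<open>g - s\<close> is that of \<open>g\<close> minus the left-hand side, and it is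
  nonnegative.\<close>

lemma Bessel_inequality:
  assumes g: "continuous_on {-pi..pi} g" and F: "finite F"
  shows "2 * pi * (\<Sum>k\<in>F. (norm (fourier_coeff (pdist_of g) k))\<^sup>2) \<le> integral {-pi..pi} (\<lambda>x. (norm (g x))\<^sup>2)"
proof -
  define c where "c = fourier_coeff (pdist_of g)"
  define s where "s x = (\<Sum>k\<in>F. c k * mode k x)" for x
  have s: "continuous_on {-pi..pi} s"
    unfolding s_def by (intro continuous_intros)
  note int = integrable_continuous_interval
  have cg: "integral {-pi..pi} (\<lambda>x. g x * mode (- k) x) = 2 * of_real pi * c k" for k
    by (simp add: c_def fcoeff_eq)
  have "integral {-pi..pi} (\<lambda>x. s x * mode (- k) x) = 2 * of_real pi * c k" if "k \<in> F" for k
  proof -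
    have "integral {-pi..pi} (\<lambda>x. s x * mode (- k) x) =
        integral {-pi..pi} (\<lambda>x. \<Sum>l\<in>F. c l * mode (l - k) x)"
      by (simp add: s_def sum_distrib_right mult.assoc mode_mult)
    also have "\<dots> = (\<Sum>l\<in>F. integral {-pi..pi} (\<lambda>x. c l * mode (l - k) x))"
      by (intro integral_sum F int continuous_intros)
    also have "\<dots> = (\<Sum>l\<in>F. if l = k then 2 * of_real pi * c k else 0)"
      by (intro sum.cong) (auto simp: integral_mode)
    finally show ?thesis using that F by simp
  qed
  then have orth: "integral {-pi..pi} (\<lambda>x. (g x - s x) * mode (- k) x) = 0" if "k \<in> F" for k
    using that by (simp add: left_diff_distrib cg integral_diff int continuous_intros g s)
  \<comment> \<open>Once \<open>cnj (s x)\<close> is expanded, each term pairs \<open>g - s\<close>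
    with a character from \<open>F\<close>, and \<open>orth\<close> annihilates it.\<close>
  have "integral {-pi..pi} (\<lambda>x. (g x - s x) * cnj (s x)) =
      integral {-pi..pi} (\<lambda>x. \<Sum>k\<in>F. cnj (c k) * ((g x - s x) * mode (- k) x))"
  proof -
    have "(g x - s x) * cnj (s x) = (\<Sum>k\<in>F. cnj (c k) * ((g x - s x) * mode (- k) x))" for x
      by (subst (2) s_def) (simp add: sum_distrib_left cnj_mode mult_ac)
    then show ?thesis by simp
  qed
  also have "\<dots> = (\<Sum>k\<in>F. integral {-pi..pi} (\<lambda>x. cnj (c k) * ((g x - s x) * mode (- k) x)))"
    by (intro integral_sum F int continuous_intros g s)
  also have "\<dots> = 0"
    by (simp add: orth)
  finally have 1: "integral {-pi..pi} (\<lambda>x. (g x - s x) * cnj (s x)) = 0" .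
  have cg': "integral {-pi..pi} (\<lambda>x. mode k x * cnj (g x)) = 2 * of_real pi * cnj (c k)" for k
    using arg_cong[OF cg[of k], of cnj] by (simp add: cnj_integral cnj_mode mult_ac)
  have "integral {-pi..pi} (\<lambda>x. s x * cnj (g x)) =
      integral {-pi..pi} (\<lambda>x. \<Sum>k\<in>F. c k * (mode k x * cnj (g x)))"
    by (simp add: s_def sum_distrib_right sum_distrib_left mult_ac)
  also have "\<dots> = (\<Sum>k\<in>F. integral {-pi..pi} (\<lambda>x. c k * (mode k x * cnj (g x))))"
    by (intro integral_sum F int continuous_intros g s)
  also have "\<dots> = of_real (2 * pi * (\<Sum>k\<in>F. (norm (c k))\<^sup>2))"
    unfolding of_real_mult of_real_sum complex_norm_square sum_distrib_left integral_mult_right cg'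
    by (intro sum.cong refl) (simp add: mult_ac)
  finally have 2: "integral {-pi..pi} (\<lambda>x. s x * cnj (g x)) = of_real (2 * pi * (\<Sum>k\<in>F. (norm (c k))\<^sup>2))" .
  have "of_real (integral {-pi..pi} (\<lambda>x. (norm (g x - s x))\<^sup>2)) =
      integral {-pi..pi} (\<lambda>x. (g x - s x) * cnj (g x - s x))"
    by (rule integral_mult_cnj_self[symmetric]) (intro continuous_intros g s)
  \<comment> \<open>The square is arranged so that, apart from the norm of \<open>g\<close>, only
    the products evaluated in 1 and 2 occur.\<close>
  also have "\<dots> = integral {-pi..pi} (\<lambda>x. g x * cnj (g x) - s x * cnj (g x) - (g x - s x) * cnj (s x))"
    by (simp add: algebra_simps)
  also have "\<dots> = integral {-pi..pi} (\<lambda>x. g x * cnj (g x)) - integral {-pi..pi} (\<lambda>x. s x * cnj (g x))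
      - integral {-pi..pi} (\<lambda>x. (g x - s x) * cnj (s x))"
    by (simp add: integral_diff int continuous_intros g s)
  also have "\<dots> = of_real (integral {-pi..pi} (\<lambda>x. (norm (g x))\<^sup>2) - 2 * pi * (\<Sum>k\<in>F. (norm (c k))\<^sup>2))"
    by (simp add: 1 2 integral_mult_cnj_self g)
  finally have "integral {-pi..pi} (\<lambda>x. (norm (g x - s x))\<^sup>2) =
      integral {-pi..pi} (\<lambda>x. (norm (g x))\<^sup>2) - 2 * pi * (\<Sum>k\<in>F. (norm (c k))\<^sup>2)"
    by (simp only: of_real_eq_iff)
  moreover have "0 \<le> integral {-pi..pi} (\<lambda>x. (norm (g x - s x))\<^sup>2)"
    by (intro integral_nonneg int continuous_intros g s) auto
  ultimately show ?thesis by (simp add: c_def)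
qed

text \<open>Bessel's inequality bounds the partial sums of the squared moduli, injectivity of
  \<open>h\<close> ensuring that no coefficient is counted twice; the terms of a convergent series
  tend to 0.\<close>

lemma Riemann_Lebesgue:
  fixes h :: "nat \<Rightarrow> int"
  assumes g: "continuous_on {-pi..pi} g" and h: "inj h"
  shows "(\<lambda>n. fourier_coeff (pdist_of g) (h n)) \<longlonglongrightarrow> 0"
proof -
  let ?a = "\<lambda>n. (norm (fourier_coeff (pdist_of g) (h n)))\<^sup>2"
  have "summable ?a"
  proof (rule summableI_nonneg_bounded)
    fix n
    have "(\<Sum>i<n. ?a i) = (\<Sum>k\<in>h ` {..<n}. (norm (fourier_coeff (pdist_of g) k))\<^sup>2)"
      using h by (simp add: sum.reindex inj_on_subset)
    then show "(\<Sum>i<n. ?a i) \<le> integral {-pi..pi} (\<lambda>x. (norm (g x))\<^sup>2) / (2 * pi)"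
      using Bessel_inequality[OF g, of "h ` {..<n}"] by (simp add: field_simps)
  qed simp
  from summable_LIMSEQ_zero[OF this] have "(\<lambda>n. sqrt (?a n)) \<longlonglongrightarrow> sqrt 0"
    by (rule tendsto_real_sqrt)
  then show ?thesis by (simp add: tendsto_norm_zero_iff)
qed

section \<open>Fourier series of test functions\<close>

lemma fcoeff_vderiv:
  assumes "test_function \<phi>"
  shows "fourier_coeff (pdist_of (vderiv \<phi>)) k = \<i> * of_int k * fourier_coeff (pdist_of \<phi>) k"
proof -
  have \<phi>: "(\<phi> has_vector_derivative vderiv \<phi> x) (at x)" for x
    using test_function_has_vderiv[OF assms, of 0 x] by simp
  let ?F = "\<lambda>x. \<phi> x * mode (- k) x"
  have "((\<lambda>x. \<phi> x * (\<i> * of_int (- k) * mode (- k) x) + vderiv \<phi> x * mode (- k) x) has_integral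
      ?F pi - ?F (- pi)) {-pi..pi}"
  proof (rule fundamental_theorem_of_calculus)
    show "(?F has_vector_derivative (\<phi> x * (\<i> * of_int (- k) * mode (- k) x) + vderiv \<phi> x * mode (- k) x))
        (at x within {-pi..pi})" for x
      by (rule has_vector_derivative_at_within, rule has_vector_derivative_mult)
        (rule \<phi> has_vector_derivative_mode)+
  qed simp
  \<comment> \<open>Periodicity cancels the boundary terms of the integration by parts.\<close>
  moreover have "?F pi = ?F (- pi)"
  proof -
    have "\<phi> (- pi + 2 * pi) = \<phi> (- pi)" "mode (- k) (- pi + 2 * pi) = mode (- k) (- pi)"
      using assms periodic_mode[of "- k"] unfolding test_function_def periodic_2pi_def by blast+
    then show ?thesis by simp
  qed
  ultimately have "integral {-pi..pi} (\<lambda>x. vderiv \<phi> x * mode (- k) x - \<i> * of_int k * (\<phi> x * mode (- k) x)) = 0"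
    by (intro integral_unique) (simp add: algebra_simps)
  then show ?thesis
    by (simp add: fcoeff_eq integral_diff integrable_continuous_interval continuous_intros
        test_function_continuous test_function_vderiv assms)
qed

lemma fcoeff_vderiv_funpow:
  assumes "test_function \<phi>"
  shows "fourier_coeff (pdist_of ((vderiv ^^ n) \<phi>)) k = (\<i> * of_int k) ^ n * fourier_coeff (pdist_of \<phi>) k"
  by (induction n) (simp_all add: fcoeff_vderiv test_function_vderiv_funpow assms)

lemma norm_fcoeff_le:
  assumes "continuous_on {-pi..pi} \<phi>" "\<And>x. x \<in> {-pi..pi} \<Longrightarrow> norm (\<phi> x) \<le> B"
  shows "norm (fourier_coeff (pdist_of \<phi>) k) \<le> B"
proof -
  have "norm (integral {-pi..pi} (\<lambda>x. \<phi> x * mode (- k) x)) \<le> integral {-pi..pi} (\<lambda>x. B)"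
    by (intro integral_norm_bound_integral integrable_continuous_interval continuous_intros assms)
      (simp add: norm_mult assms)
  then show ?thesis
    by (simp add: fcoeff_eq norm_divide norm_mult field_simps)
qed

lemma summable_on_inverse_square_int: "(\<lambda>k::int. inverse ((1 + of_int \<bar>k\<bar>)\<^sup>2 :: real)) summable_on UNIV"
proof -
  let ?f = "\<lambda>k::int. inverse ((1 + of_int \<bar>k\<bar>)\<^sup>2 :: real)"
  have s: "summable (\<lambda>n. inverse (real (Suc n) ^ 2))" "summable (\<lambda>n. inverse (real (Suc (Suc n)) ^ 2))"
    using summable_ignore_initial_segment[OF inverse_power_summable[of 2, where 'a = real], of 1]
      summable_ignore_initial_segment[OF inverse_power_summable[of 2, where 'a = real], of 2]
    by (simp_all add: add.commute)
  \<comment> \<open>The nonnegative integers give the terms \<open>1 / (n + 1)^2\<close>; the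
    negative ones, listed as \<open>- int (Suc n)\<close>, give
    \<open>1 / (n + 2)^2\<close>.\<close>
  have "?f summable_on range int"
    using norm_summable_imp_summable_on[of "?f \<circ> int"] s(1)
    by (subst summable_on_reindex) (auto simp: o_def add.commute)
  moreover have "?f summable_on range (\<lambda>n. - int (Suc n))"
    using norm_summable_imp_summable_on[of "?f \<circ> (\<lambda>n. - int (Suc n))"] s(2)
    by (subst summable_on_reindex) (auto simp: o_def add_ac inj_def)
  moreover have "range int \<inter> range (\<lambda>n. - int (Suc n)) = {}" by auto
  moreover have "range int \<union> range (\<lambda>n. - int (Suc n)) = UNIV"
  proof -
    have "k \<in> range int \<union> range (\<lambda>n. - int (Suc n))" for k
      by (cases k rule: int_cases) (blast intro: rangeI)+
    then show ?thesis by blast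
  qed
  ultimately show ?thesis
    using summable_on_Un_disjoint by metis
qed

text \<open>Bounds on the function and its first two derivatives give coefficients of order 1 / (1 +
  |k|)^2, which is summable.\<close>

lemma abs_summable_fcoeff:
  assumes "test_function \<phi>"
  shows "(\<lambda>k. norm (fourier_coeff (pdist_of \<phi>) k)) summable_on UNIV"
proof -
  let ?c = "fourier_coeff (pdist_of \<phi>)"
  have "\<exists>B. \<forall>x\<in>{-pi..pi}. norm ((vderiv ^^ n) \<phi> x) \<le> B" for n
    using test_function_bdd_above[OF test_function_vderiv_funpow[OF assms]]
    by (auto simp: bdd_above_def)
  then obtain B where B: "\<And>n x. x \<in> {-pi..pi} \<Longrightarrow> norm ((vderiv ^^ n) \<phi> x) \<le> B n"
    by metis
  have bound: "\<bar>of_int k\<bar> ^ n * norm (?c k) \<le> B n" for n k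
    using norm_fcoeff_le[OF test_function_continuous[OF test_function_vderiv_funpow[OF assms]] B, of n k]
    by (simp add: fcoeff_vderiv_funpow assms norm_mult norm_power)
  \<comment> \<open>The weights come from (1 + |k|)^2 = 1 + 2 |k| + |k|^2, bounded term by
    term.\<close>
  define C where "C = B 0 + 2 * B 1 + B 2"
  have "norm (?c k) \<le> C * inverse ((1 + of_int \<bar>k\<bar>)\<^sup>2)" for k
  proof -
    have "(1 + of_int \<bar>k\<bar>)\<^sup>2 * norm (?c k) \<le> C"
      using bound[of k 0] bound[of k 1] bound[of k 2]
      by (simp add: C_def power2_eq_square algebra_simps)
    then show ?thesis
      by (simp add: field_simps flip: power2_eq_square)
  qed
  then show ?thesis
    by (rule Infinite_Sum.abs_summable_on_comparison_test'[OF summable_on_cmult_right[OF summable_on_inverse_square_int]])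
qed

lemma has_vector_derivative_imp_tendsto_quotient:
  fixes f :: "real \<Rightarrow> complex"
  assumes "(f has_vector_derivative D) (at 0)"
  shows "((\<lambda>x. (f x - f 0) / of_real x) \<longlongrightarrow> D) (at 0)"
proof -
  have "((\<lambda>y. norm (f y - f 0 - y *\<^sub>R D) / norm y) \<longlongrightarrow> 0) (at 0)"
    using assms by (simp add: has_vector_derivative_def has_derivative_iff_norm)
  moreover have "eventually (\<lambda>y. norm (f y - f 0 - y *\<^sub>R D) / norm y = norm ((f y - f 0) / of_real y - D)) (at 0)"
  proof (rule eventually_at_topological[THEN iffD2], rule exI[of _ UNIV], intro conjI ballI impI)
    fix y :: real assume "y \<noteq> 0"
    then have "(f y - f 0) / of_real y - D = (f y - f 0 - y *\<^sub>R D) / of_real y"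
      by (simp add: field_simps scaleR_conv_of_real)
    then show "norm (f y - f 0 - y *\<^sub>R D) / norm y = norm ((f y - f 0) / of_real y - D)"
      by (simp only: norm_divide norm_of_real real_norm_def)
  qed auto
  ultimately have "((\<lambda>y. norm ((f y - f 0) / of_real y - D)) \<longlongrightarrow> 0) (at 0)"
    using tendsto_cong by fast
  then show ?thesis
    by (simp add: tendsto_norm_zero_iff LIM_zero_iff)
qed

lemma mode_1_eq_1:
  assumes "mode 1 x = 1" "\<bar>x\<bar> \<le> pi"
  shows "x = 0"
proof -
  have "cos \<bar>x\<bar> = cos 0"
    using assms(1) by (simp add: mode_def complex_eq_iff)
  then show ?thesis
    using assms(2) cos_inj_pi[of "\<bar>x\<bar>" 0] by simp
qed

text \<open>The difference quotient of \<open>\<phi>\<close> by \<open>mode 1 - 1\<close> is continuous,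
  so its coefficients vanish at infinity.\<close>

lemma fourier_partial_sums_at_0:
  assumes \<phi>: "test_function \<phi>"
  shows "(\<lambda>n. \<Sum>k\<in>{- int n..int n}. fourier_coeff (pdist_of \<phi>) k) \<longlonglongrightarrow> \<phi> 0"
proof -
  \<comment> \<open>The value at 0 is the limit of the quotient: dividing numerator and denominator
    by \<open>x\<close> gives two difference quotients, and \<open>mode 1\<close> has derivative
    \<open>\<i>\<close> at 0.\<close>
  define g where "g x = (if x = 0 then vderiv \<phi> 0 / \<i> else (\<phi> x - \<phi> 0) / (mode 1 x - 1))" for x
  let ?g = "fourier_coeff (pdist_of g)"
  have g_eq: "(mode 1 x - 1) * g x = \<phi> x - \<phi> 0" if "x \<in> {-pi..pi}" for x
    using mode_1_eq_1[of x] that by (auto simp: g_def abs_le_iff)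
  have "isCont g x" if x: "x \<in> {-pi..pi}" for x
  proof (cases "x = 0")
    case True
    have "((\<lambda>x. ((\<phi> x - \<phi> 0) / of_real x) / ((mode 1 x - mode 1 0) / of_real x)) \<longlongrightarrow> vderiv \<phi> 0 / \<i>) (at 0)"
      using test_function_has_vderiv[OF \<phi>, of 0 0] has_vector_derivative_mode[of 1 0]
      by (intro tendsto_divide has_vector_derivative_imp_tendsto_quotient) simp_all
    moreover have "eventually (\<lambda>x. ((\<phi> x - \<phi> 0) / of_real x) / ((mode 1 x - mode 1 0) / of_real x) = g x) (at 0)"
      by (rule eventually_at_topological[THEN iffD2], intro exI[of _ UNIV]) (auto simp: g_def)
    ultimately have "(g \<longlongrightarrow> vderiv \<phi> 0 / \<i>) (at 0)"
      using tendsto_cong by fast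
    then show ?thesis
      by (simp add: True isCont_def g_def)
  next
    case False
    have "mode 1 x \<noteq> 1"
      using mode_1_eq_1[of x] x False by (auto simp: abs_le_iff)
    then have "isCont (\<lambda>x. (\<phi> x - \<phi> 0) / (mode 1 x - 1)) x"
      using test_function_continuous[OF \<phi>, of UNIV] continuous_on_mode[of UNIV 1]
      by (intro continuous_intros) (auto simp: continuous_on_eq_continuous_at)
    moreover have "eventually (\<lambda>y. (\<phi> y - \<phi> 0) / (mode 1 y - 1) = g y) (nhds x)"
    proof (rule eventually_mono)
      show "eventually (\<lambda>y. y \<in> - {0}) (nhds x)"
        by (rule eventually_nhds_in_open) (use False in auto)
    qed (simp add: g_def)
    ultimately show ?thesis using isCont_cong by fast
  qed
  then have g: "continuous_on {-pi..pi} g"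
    by (simp add: continuous_at_imp_continuous_on)
  note int = integrable_continuous_interval
  \<comment> \<open>Multiplication by \<open>mode 1\<close> shifts the coefficient index by one, so
    the coefficients of \<open>(mode 1 - 1) * g\<close> are differences of neighbouring coefficients
    of \<open>g\<close>; the constant \<phi> 0 contributes only at \<open>k = 0\<close>.\<close>
  have c: "fourier_coeff (pdist_of \<phi>) k = (if k = 0 then \<phi> 0 else 0) + (?g (k - 1) - ?g k)" for k
  proof -
    have "integral {-pi..pi} (\<lambda>x. \<phi> x * mode (- k) x) =
        integral {-pi..pi} (\<lambda>x. \<phi> 0 * mode (- k) x + (g x * mode (- (k - 1)) x - g x * mode (- k) x))"
    proof (rule integral_cong)
      fix x assume "x \<in> {-pi..pi}"
      then have "\<phi> x = \<phi> 0 + (mode 1 x - 1) * g x" by (simp add: g_eq)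
      moreover have "mode (- (k - 1)) x = mode 1 x * mode (- k) x" by (simp add: mode_mult)
      ultimately show "\<phi> x * mode (- k) x =
          \<phi> 0 * mode (- k) x + (g x * mode (- (k - 1)) x - g x * mode (- k) x)"
        by (simp only: ring_distribs mult_ac mult_1_left)
    qed
    also have "\<dots> = \<phi> 0 * integral {-pi..pi} (mode (- k)) +
        (integral {-pi..pi} (\<lambda>x. g x * mode (- (k - 1)) x) - integral {-pi..pi} (\<lambda>x. g x * mode (- k) x))"
      by (simp add: integral_add integral_diff int continuous_intros g del: minus_diff_eq)
    finally show ?thesis
      by (simp add: fcoeff_eq integral_mode add_divide_distrib diff_divide_distrib)
  qed
  \<comment> \<open>The differences telescope to the two end terms, with indices -n - 1 and
    n.\<close>
  have "(\<Sum>k\<in>{- int n..int n}. fourier_coeff (pdist_of \<phi>) k) = \<phi> 0 + (?g (- int (Suc n)) - ?g (int n))" for n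
  proof (induction n)
    case (Suc n)
    have "{- int (Suc n)..int (Suc n)} = insert (- int (Suc n)) (insert (int (Suc n)) {- int n..int n})"
      by auto
    then show ?case
      using Suc by (simp add: c)
  qed (simp add: c)
  moreover have "(\<lambda>n. \<phi> 0 + (?g (- int (Suc n)) - ?g (int n))) \<longlonglongrightarrow> \<phi> 0 + (0 - 0)"
    by (intro tendsto_intros Riemann_Lebesgue g) (auto simp: inj_def)
  ultimately show ?thesis by simp
qed

lemma fcoeff_translate:
  assumes "periodic_2pi f"
  shows "fourier_coeff (pdist_of (\<lambda>x. f (x + h))) k = fourier_coeff (pdist_of f) k * mode k h"
proof -
  have 1: "mode (- k) x = mode k h * mode (- k) (x + h)" for x
    by (simp add: mode_add mode_mult mult.left_commute)
  have "periodic_2pi (\<lambda>x. f x * mode (- k) x)"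
    using assms periodic_mode[of "- k"] by (simp add: periodic_2pi_def)
  from integral_periodic_shift[OF this, of h] show ?thesis
    unfolding fcoeff_eq by (subst 1) (simp add: mult.left_commute)
qed

text \<open>Translation by \<open>x\<close> moves the evaluation point to 0 and multiplies the
  coefficients by \<open>mode k x\<close>. Absolute summability provides some sum, and the symmetric
  partial sums identify its value.\<close>

lemma fourier_series_has_sum:
  assumes \<phi>: "test_function \<phi>"
  shows "((\<lambda>k. fourier_coeff (pdist_of \<phi>) k * mode k x) has_sum \<phi> x) UNIV"
proof -
  define \<psi> where "\<psi> = (\<lambda>y. \<phi> (y + x))"
  have \<psi>: "test_function \<psi>"
    unfolding \<psi>_def by (rule test_function_translate[OF \<phi>])
  have "fourier_coeff (pdist_of \<psi>) summable_on UNIV"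
    using abs_summable_fcoeff[OF \<psi>] by (rule abs_summable_summable)
  then obtain s where s: "(fourier_coeff (pdist_of \<psi>) has_sum s) UNIV"
    by (auto simp: summable_on_def)
  \<comment> \<open>Every finite set of integers lies in a symmetric interval, so the unordered sum
    is also the limit of the symmetric partial sums.\<close>
  have "filterlim (\<lambda>n. {- int n..int n}) (finite_subsets_at_top UNIV) sequentially"
    unfolding filterlim_finite_subsets_at_top
  proof safe
    fix X :: "int set" assume X: "finite X"
    have "\<forall>n\<ge>nat (Max (abs ` X)). X \<subseteq> {- int n..int n}"
    proof safe
      fix n k assume "nat (Max (abs ` X)) \<le> n" "k \<in> X"
      moreover from this have "\<bar>k\<bar> \<le> Max (abs ` X)" using X by simp
      ultimately show "k \<in> {- int n..int n}" by auto
    qed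
    then show "eventually (\<lambda>n. finite {- int n..int n} \<and> X \<subseteq> {- int n..int n} \<and> {- int n..int n} \<subseteq> UNIV) sequentially"
      unfolding eventually_sequentially by auto
  qed
  from filterlim_compose[OF s[unfolded has_sum_def] this] fourier_partial_sums_at_0[OF \<psi>]
  have "s = \<psi> 0"
    by (rule LIMSEQ_unique)
  moreover have "fourier_coeff (pdist_of \<psi>) = (\<lambda>k. fourier_coeff (pdist_of \<phi>) k * mode k x)"
    unfolding \<psi>_def using \<phi> by (intro ext fcoeff_translate) (simp add: test_function_def)
  ultimately show ?thesis
    using s by (simp add: \<psi>_def)
qed

section \<open>Expansion of periodic distributions\<close>

lemma norm_has_sum_diff_finite_le:
  fixes f :: "'a \<Rightarrow> 'b::banach"
  assumes "(f has_sum a) UNIV" "((\<lambda>k. norm (f k)) has_sum A) UNIV" "finite F"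
  shows "norm (a - sum f F) \<le> A - (\<Sum>k\<in>F. norm (f k))"
proof -
  have "(f has_sum (a - sum f F)) (UNIV - F)"
    by (rule has_sum_Diff) (use assms in auto)
  moreover have "((\<lambda>k. norm (f k)) has_sum (A - (\<Sum>k\<in>F. norm (f k)))) (UNIV - F)"
    by (rule has_sum_Diff) (use assms in auto)
  ultimately show ?thesis
    by (rule norm_has_sum_bound[rotated])
qed

text \<open>Finite parts of the Fourier series converge to \<phi> uniformly together with each
  derivative, and the continuity estimate for \<open>T\<close> controls the error by finitely many
  of these uniform norms.\<close>

lemma periodic_distribution_fourier_has_sum:
  assumes T: "periodic_distribution T" and \<phi>: "test_function \<phi>"
  shows "((\<lambda>k. fourier_coeff (pdist_of \<phi>) k * T (mode k)) has_sum T \<phi>) UNIV"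
proof -
  obtain N C where C: "\<And>\<phi>. test_function \<phi> \<Longrightarrow>
      norm (T \<phi>) \<le> C * (\<Sum>n\<le>N. SUP x\<in>{-pi..pi}. norm ((vderiv ^^ n) \<phi> x))"
    using T unfolding periodic_distribution_def by metis
  let ?c = "fourier_coeff (pdist_of \<phi>)"
  let ?d = "\<lambda>n. fourier_coeff (pdist_of ((vderiv ^^ n) \<phi>))"
  define S where "S F x = (\<Sum>k\<in>F. ?c k * mode k x)" for F x
  have "\<exists>A. ((\<lambda>k. norm (?d n k)) has_sum A) UNIV" for n
    using abs_summable_fcoeff[OF test_function_vderiv_funpow[OF \<phi>]] by (simp add: summable_on_def)
  then obtain A where A: "\<And>n. ((\<lambda>k. norm (?d n k)) has_sum A n) UNIV"
    by metis
  \<comment> \<open>\<open>r n F\<close> is the tail of the absolutely convergent coefficient series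
    of the \<open>n\<close>-th derivative: a bound independent of \<open>x\<close> that tends to
    0.\<close>
  define r where "r n F = A n - (\<Sum>k\<in>F. norm (?d n k))" for n F
  have r: "norm ((vderiv ^^ n) (\<lambda>x. \<phi> x + - 1 * S F x) x) \<le> r n F" if "finite F" for n F x
  proof -
    have "test_function (S F)"
      using test_function_sum_mode[OF that, of ?c "\<lambda>k. k"] by (simp add: S_def[abs_def])
    then have "(vderiv ^^ n) (\<lambda>x. \<phi> x + - 1 * S F x) x = (vderiv ^^ n) \<phi> x + - 1 * (vderiv ^^ n) (S F) x"
      by (simp only: vderiv_funpow_add[OF \<phi> test_function_cmult] vderiv_funpow_cmult)
    also have "(vderiv ^^ n) (S F) x = (\<Sum>k\<in>F. ?d n k * mode k x)"
      using vderiv_funpow_sum_mode[OF that, of n ?c "\<lambda>k. k"]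
      by (simp add: S_def[abs_def] fcoeff_vderiv_funpow \<phi> mult_ac)
    finally show ?thesis
      using norm_has_sum_diff_finite_le[OF fourier_series_has_sum[OF test_function_vderiv_funpow[OF \<phi>, of n], of x] _ that, of "A n"] A[of n]
      by (simp add: norm_mult r_def)
  qed
  have bound: "norm (T \<phi> - (\<Sum>k\<in>F. ?c k * T (mode k))) \<le> \<bar>C\<bar> * (\<Sum>n\<le>N. r n F)" if F: "finite F" for F
  proof -
    have S: "test_function (S F)" "T (S F) = (\<Sum>k\<in>F. ?c k * T (mode k))"
      using test_function_sum_mode[OF F, of ?c "\<lambda>k. k"]
        periodic_distribution_sum_mode[OF F T, of ?c "\<lambda>k. k"] by (simp_all add: S_def[abs_def])
    have mS: "test_function (\<lambda>x. - 1 * S F x)"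
      by (rule test_function_cmult) (rule S)
    have "T (\<lambda>x. \<phi> x + - 1 * S F x) = T \<phi> + T (\<lambda>x. - 1 * S F x)"
      using T \<phi> mS unfolding periodic_distribution_def by blast
    also have "T (\<lambda>x. - 1 * S F x) = - 1 * T (S F)"
      using T S(1) unfolding periodic_distribution_def by blast
    finally have "norm (T \<phi> - (\<Sum>k\<in>F. ?c k * T (mode k))) = norm (T (\<lambda>x. \<phi> x + - 1 * S F x))"
      by (simp add: S)
    also have "\<dots> \<le> C * (\<Sum>n\<le>N. SUP x\<in>{-pi..pi}. norm ((vderiv ^^ n) (\<lambda>x. \<phi> x + - 1 * S F x) x))"
      by (rule C) (rule test_function_add[OF \<phi> mS])
    \<comment> \<open>The constant \<open>C\<close> comes without a sign; enlarging it to
      \<open>\<bar>C\<bar>\<close> requires the sum of suprema to be nonnegative.\<close>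
    also have "\<dots> \<le> \<bar>C\<bar> * (\<Sum>n\<le>N. SUP x\<in>{-pi..pi}. norm ((vderiv ^^ n) (\<lambda>x. \<phi> x + - 1 * S F x) x))"
    proof (rule mult_right_mono)
      show "0 \<le> (\<Sum>n\<le>N. SUP x\<in>{-pi..pi}. norm ((vderiv ^^ n) (\<lambda>x. \<phi> x + - 1 * S F x) x))"
      proof (rule sum_nonneg)
        fix n
        have "bdd_above ((\<lambda>x. norm ((vderiv ^^ n) (\<lambda>x. \<phi> x + - 1 * S F x) x)) ` {-pi..pi})"
          by (intro test_function_bdd_above test_function_vderiv_funpow test_function_add \<phi> mS)
        then show "0 \<le> (SUP x\<in>{-pi..pi}. norm ((vderiv ^^ n) (\<lambda>x. \<phi> x + - 1 * S F x) x))"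
          by (rule cSUP_upper2[where x = 0]) auto
      qed
    qed simp
    also have "\<dots> \<le> \<bar>C\<bar> * (\<Sum>n\<le>N. r n F)"
      by (intro mult_left_mono sum_mono cSUP_least r F) auto
    finally show ?thesis .
  qed
  have "((\<lambda>F. \<bar>C\<bar> * (\<Sum>n\<le>N. r n F)) \<longlongrightarrow> \<bar>C\<bar> * (\<Sum>n\<le>N. A n - A n)) (finite_subsets_at_top UNIV)"
    unfolding r_def using A by (intro tendsto_intros) (simp add: has_sum_def)
  then have lim: "((\<lambda>F. \<bar>C\<bar> * (\<Sum>n\<le>N. r n F)) \<longlongrightarrow> 0) (finite_subsets_at_top UNIV)"
    by simp
  have "((\<lambda>F. T \<phi> - (\<Sum>k\<in>F. ?c k * T (mode k))) \<longlongrightarrow> 0) (finite_subsets_at_top UNIV)"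
    by (rule Lim_null_comparison[OF _ lim]) (auto intro!: bound)
  then have "((\<lambda>F. T \<phi> - (T \<phi> - (\<Sum>k\<in>F. ?c k * T (mode k)))) \<longlongrightarrow> T \<phi> - 0) (finite_subsets_at_top UNIV)"
    by (intro tendsto_intros)
  then show ?thesis
    by (simp add: has_sum_def)
qed

lemma pdist_of_mode:
  "pdist_of (mode k) \<phi> = 2 * of_real pi * fourier_coeff (pdist_of \<phi>) (- k)"
  by (simp add: fcoeff_eq) (simp add: pdist_of_def mult.commute)

text \<open>Replacing \<open>k\<close> by \<open>- k\<close> exchanges the roles of \<open>T\<close>
  and \<phi>, since pairing with \<open>mode k\<close> reads off the coefficient of \<phi> at
  \<open>- k\<close>. Hence a distribution is determined on test functions by its Fourier
  coefficients.\<close>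

lemma periodic_distribution_has_sum:
  assumes "periodic_distribution T" "test_function \<phi>"
  shows "((\<lambda>k. fourier_coeff T k * pdist_of (mode k) \<phi>) has_sum T \<phi>) UNIV"
proof -
  have "((\<lambda>k. fourier_coeff (pdist_of \<phi>) (- k) * T (mode (- k))) has_sum T \<phi>) UNIV"
    using periodic_distribution_fourier_has_sum[OF assms]
    by (rule has_sum_reindex_bij_betw[THEN iffD2, rotated]) (simp add: bij_uminus)
  moreover have "fourier_coeff (pdist_of \<phi>) (- k) * T (mode (- k)) =
      fourier_coeff T k * pdist_of (mode k) \<phi>" for k
    unfolding pdist_of_mode fourier_coeff_mode[of T] by simp
  ultimately show ?thesis by simp
qed

text \<open>The L1 norm of \<open>f\<close> times the supremum of the test function bounds the
  pairing, so the continuity estimate holds with \<open>N = 0\<close>.\<close>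

lemma periodic_distribution_pdist_of:
  assumes f: "f absolutely_integrable_on {-pi..pi}"
  shows "periodic_distribution (pdist_of f)"
proof -
  have int: "(\<lambda>x. f x * \<phi> x) integrable_on {-pi..pi}" if "test_function \<phi>" for \<phi>
  proof -
    have "continuous_on {-pi..pi} \<phi>" by (rule test_function_continuous[OF that])
    then have "(\<lambda>x. \<phi> x * f x) absolutely_integrable_on {-pi..pi}"
      by (intro absolutely_integrable_bounded_measurable_product[OF bilinear_times] f
          continuous_imp_measurable_on_sets_lebesgue compact_imp_bounded compact_continuous_image) auto
    then show ?thesis
      by (simp add: mult.commute set_lebesgue_integral_eq_integral(1))
  qed
  have "norm (pdist_of f \<phi>) \<le>
      integral {-pi..pi} (\<lambda>x. norm (f x)) * (\<Sum>n\<le>(0::nat). SUP x\<in>{-pi..pi}. norm ((vderiv ^^ n) \<phi> x))"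
    if \<phi>: "test_function \<phi>" for \<phi>
  proof -
    have "norm (pdist_of f \<phi>) \<le> integral {-pi..pi} (\<lambda>x. norm (f x) * (SUP x\<in>{-pi..pi}. norm (\<phi> x)))"
      unfolding pdist_of_def
    proof (rule integral_norm_bound_integral)
      show "(\<lambda>x. norm (f x) * (SUP x\<in>{-pi..pi}. norm (\<phi> x))) integrable_on {-pi..pi}"
        using f by (intro integrable_on_mult_left) (simp add: absolutely_integrable_on_def)
      show "norm (f x * \<phi> x) \<le> norm (f x) * (SUP x\<in>{-pi..pi}. norm (\<phi> x))" if "x \<in> {-pi..pi}" for x
        unfolding norm_mult
        by (intro mult_left_mono cSUP_upper that test_function_bdd_above \<phi>) simp
    qed (rule int[OF \<phi>])
    then show ?thesis by simp
  qed
  moreover have "pdist_of f (\<lambda>x. \<phi> x + \<psi> x) = pdist_of f \<phi> + pdist_of f \<psi>"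
    if "test_function \<phi>" "test_function \<psi>" for \<phi> \<psi>
    using that by (simp add: pdist_of_def ring_distribs integral_add int)
  moreover have "pdist_of f (\<lambda>x. c * \<phi> x) = c * pdist_of f \<phi>" for c \<phi>
    by (simp add: pdist_of_def mult.left_commute)
  ultimately show ?thesis
    unfolding periodic_distribution_def by blast
qed

section \<open>Discrete Fourier inversion\<close>

lemma sum_roots_of_unity:
  fixes M :: nat
  assumes "M > 0"
  shows "(\<Sum>j<M. cis (2 * pi * of_int l * real j / real M)) = (if int M dvd l then of_nat M else 0)"
proof -
  \<comment> \<open>The sum is geometric with ratio \<open>w\<close>, and \<open>w ^ M = 1\<close>;
    it vanishes unless \<open>w = 1\<close>, that is, unless \<open>M\<close> divides
    \<open>l\<close>.\<close>
  define w where "w = cis (2 * pi * of_int l / real M)"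
  have pow: "cis (2 * pi * of_int l * real j / real M) = w ^ j" for j
    unfolding w_def Complex.DeMoivre by (rule arg_cong[where f = cis]) (simp add: field_simps)
  have "w = 1 \<longleftrightarrow> int M dvd l"
  proof
    assume "w = 1"
    then have "cos (2 * pi * of_int l / real M) = 1"
      by (simp add: w_def complex_eq_iff)
    then obtain n :: int where "2 * pi * of_int l / real M = of_int n * 2 * pi"
      using cos_one_2pi_int by auto
    then have "real_of_int l = of_int (n * int M)"
      using assms by (simp add: field_simps)
    then show "int M dvd l"
      unfolding of_int_eq_iff by simp
  next
    assume "int M dvd l"
    then obtain n where "l = int M * n" by blast
    then have "w = cis (2 * pi * of_int n)"
      unfolding w_def using assms by (intro arg_cong[where f = cis]) (simp add: field_simps)
    also have "\<dots> = 1" by (rule cis_multiple_2pi) auto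
    finally show "w = 1" .
  qed
  moreover have "w ^ M = cis (2 * pi * of_int l)"
    unfolding w_def Complex.DeMoivre using assms by (intro arg_cong[where f = cis]) (simp add: field_simps)
  moreover have "cis (2 * pi * of_int l) = 1" by (rule cis_multiple_2pi) auto
  ultimately show ?thesis
    by (cases "w = 1") (simp_all add: pow geometric_sum)
qed

text \<open>The Hermitian symmetry of \<open>E\<close> permits replacing the complex
  coefficients by their real parts.\<close>

lemma real_dft_inversion:
  fixes M :: nat and E :: "int \<Rightarrow> complex"
  assumes M: "M > 0" and per: "\<And>k. E (k + int M) = E k" and herm: "\<And>k. E (- k) = cnj (E k)"
  obtains a :: "nat \<Rightarrow> real" where
    "\<And>k. (\<Sum>j<M. of_real (a j) * mode k (2 * pi * real j / real M)) = E k"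
proof
  \<comment> \<open>\<open>A\<close> is the normalised discrete Fourier transform of
    \<open>E\<close> over one period.\<close>
  define A where "A j = (\<Sum>m<M. E (int m) * mode (- int m) (2 * pi * real j / real M)) / of_nat M" for j
  have per': "E (k + int M * n) = E k" for k n
  proof (induction n rule: int_induct[where k = 0])
    case (step1 i)
    with per[of "k + int M * i"] show ?case by (simp add: algebra_simps)
  next
    case (step2 i)
    with per[of "k + int M * (i - 1)"] show ?case by (simp add: algebra_simps)
  qed simp
  have inv: "(\<Sum>j<M. A j * mode k (2 * pi * real j / real M)) = E k" for k
  proof -
    have "(\<Sum>j<M. A j * mode k (2 * pi * real j / real M)) =
        (\<Sum>j<M. \<Sum>m<M. E (int m) * cis (2 * pi * of_int (k - int m) * real j / real M)) / of_nat M"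
      by (simp add: A_def sum_divide_distrib sum_distrib_right mult.assoc mode_mult)
        (simp add: mode_def mult_ac)
    also have "(\<Sum>j<M. \<Sum>m<M. E (int m) * cis (2 * pi * of_int (k - int m) * real j / real M)) =
        (\<Sum>m<M. E (int m) * (\<Sum>j<M. cis (2 * pi * of_int (k - int m) * real j / real M)))"
      by (subst sum.swap) (simp add: sum_distrib_left)
    \<comment> \<open>Orthogonality leaves only the residue of \<open>k\<close> modulo
      \<open>M\<close>, where \<open>E\<close> takes the value \<open>E k\<close> by
      periodicity.\<close>
    also have "\<dots> = (\<Sum>m<M. if m = nat (k mod int M) then of_nat M * E k else 0)"
    proof (rule sum.cong[OF refl])
      fix m assume m: "m \<in> {..<M}"
      have iff: "int M dvd k - int m \<longleftrightarrow> m = nat (k mod int M)"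
        using m M by (auto simp: mod_eq_dvd_iff[symmetric] nat_eq_iff)
      have "E (int m) = E k" if "int M dvd k - int m"
      proof -
        obtain n where "k - int m = int M * n" using \<open>int M dvd k - int m\<close> by blast
        then have "k = int m + int M * n" by simp
        then show ?thesis by (simp add: per')
      qed
      then show "E (int m) * (\<Sum>j<M. cis (2 * pi * of_int (k - int m) * real j / real M)) =
          (if m = nat (k mod int M) then of_nat M * E k else 0)"
        unfolding sum_roots_of_unity[OF M] iff by auto
    qed
    also have "\<dots> = of_nat M * E k"
      using M by (simp add: nat_less_iff)
    finally show ?thesis using M by simp
  qed
  fix k
  \<comment> \<open>Conjugating the inversion formula at \<open>- k\<close> shows that the numbers
    \<open>cnj (A j)\<close> represent \<open>E\<close> as well; averaging the two representations
    leaves the real parts.\<close>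
  have "cnj (\<Sum>j<M. A j * mode (- k) (2 * pi * real j / real M)) = E k"
    by (simp only: inv herm complex_cnj_cnj)
  then have inv': "(\<Sum>j<M. cnj (A j) * mode k (2 * pi * real j / real M)) = E k"
    by (simp add: cnj_mode)
  have Re: "of_real (Re z) = (z + cnj z) / 2" for z
    by (simp add: complex_add_cnj)
  have "(\<Sum>j<M. of_real (Re (A j)) * mode k (2 * pi * real j / real M)) =
      ((\<Sum>j<M. A j * mode k (2 * pi * real j / real M)) +
       (\<Sum>j<M. cnj (A j) * mode k (2 * pi * real j / real M))) / 2"
    unfolding sum.distrib[symmetric] sum_divide_distrib Re
    by (intro sum.cong refl) (simp add: ring_distribs)
  also have "\<dots> = E k"
    by (simp only: inv inv') simp
  finally show "(\<Sum>j<M. of_real (Re (A j)) * mode k (2 * pi * real j / real M)) = E k" .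
qed

section \<open>Evolution of single modes\<close>

lemma has_vector_derivative_cis_linear:
  "((\<lambda>t. cis (l * t)) has_vector_derivative \<i> * of_real l * cis (l * t)) (at t)"
  unfolding has_vector_derivative_def
  by (auto intro!: derivative_eq_intros simp: fun_eq_iff scaleR_conv_of_real field_simps)

text \<open>Multiplication by the integrating factor \<open>cis (- l * t)\<close> gives a function
  with zero derivative, hence a constant.\<close>

lemma linear_ode_solution:
  assumes "\<And>t. (c has_vector_derivative \<i> * of_real l * c t) (at t)"
  shows "c t = cis (l * t) * c 0"
proof -
  have "((\<lambda>t. cis (- l * t) * c t) has_vector_derivative 0) (at t within UNIV)" for t
    using has_vector_derivative_mult[OF has_vector_derivative_cis_linear[of "- l" t] assms[of t]]
    by (simp add: mult_ac)
  then obtain C where C: "\<And>t. cis (- l * t) * c t = C"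
    using has_vector_derivative_zero_constant[of UNIV "\<lambda>t. cis (- l * t) * c t"] by auto
  have "c t = cis (l * t) * (cis (- l * t) * c t)"
    by (simp add: cis_mult flip: mult.assoc del: mult_minus_left)
  also have "\<dots> = cis (l * t) * c 0"
    unfolding C using C[of 0] by simp
  finally show ?thesis .
qed

lemma BO_solution_fourier_coeff:
  assumes u: "BO_solution f u"
  shows "fourier_coeff (u t) k = cis (of_int (\<bar>k\<bar> * k) * t) * fourier_coeff (pdist_of f) k"
proof -
  have "fourier_coeff (hilbert (pdist_deriv (pdist_deriv (u t)))) k =
      \<i> * of_real (of_int (\<bar>k\<bar> * k)) * fourier_coeff (u t) k" for t
  proof -
    \<comment> \<open>The two sign changes of \<open>pdist_deriv\<close> cancel, and both
      derivatives fall on the test function \<open>mode (- k)\<close>.\<close>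
    have "vderiv (vderiv (mode (- k))) = (\<lambda>x. (\<i> * of_int (- k))\<^sup>2 * mode (- k) x)"
      using vderiv_funpow_mode[of 2 "- k"] by (simp add: numeral_2_eq_2)
    moreover have "u t (\<lambda>x. (\<i> * of_int (- k))\<^sup>2 * mode (- k) x) = (\<i> * of_int (- k))\<^sup>2 * u t (mode (- k))"
      using u test_function_mode unfolding BO_solution_def periodic_distribution_def by blast
    ultimately have "fourier_coeff (pdist_deriv (pdist_deriv (u t))) k = - (of_int k)\<^sup>2 * fourier_coeff (u t) k"
      by (simp add: fourier_coeff_mode pdist_deriv_def power_mult_distrib)
    \<comment> \<open>The factor -1 from the second derivative turns the Hilbert multiplier into
      \<open>\<i> * sgn k\<close>, and this identity absorbs the sign into |k| k.\<close>
    moreover have "of_int (sgn k) * (of_int k)\<^sup>2 = (of_int (\<bar>k\<bar> * k) :: complex)"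
      by (cases k "0 :: int" rule: linorder_cases) (auto simp: power2_eq_square)
    ultimately show ?thesis
      by (cases k "0 :: int" rule: linorder_cases) (auto simp: fourier_coeff_hilbert power2_eq_square)
  qed
  then have "((\<lambda>s. fourier_coeff (u s) k) has_vector_derivative
      \<i> * of_real (of_int (\<bar>k\<bar> * k)) * fourier_coeff (u t) k) (at t)" for t
    using u unfolding BO_solution_def by metis
  from linear_ode_solution[OF this, of t] show ?thesis
    using u by (simp add: BO_solution_def)
qed

section \<open>The multiplier at rational times\<close>

lemma dispersion_multiplier:
  fixes p :: int and q :: nat
  assumes q: "q \<ge> 1"
  obtains a b :: "nat \<Rightarrow> real" where
    "\<And>k. (\<Sum>j<2*q. of_real (a j) * mode k (pi * real j / real q)) +
      (- \<i> * of_int (sgn k)) * (\<Sum>j<2*q. of_real (b j) * mode k (pi * real j / real q)) =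
      cis (of_int (\<bar>k\<bar> * k) * (pi * of_int p / real q))"
proof -
  define \<theta> where "\<theta> k = pi * of_int p * (of_int k)\<^sup>2 / real q" for k :: int
  \<comment> \<open>Expanding the square changes the phase by \<open>4 * pi * p * (k + q)\<close>, a
    multiple of 2 pi. A shift by \<open>q\<close> would change it by
    \<open>pi * p * (2 * k + q)\<close>, in general only a multiple of pi; hence
    \<open>2 * q\<close> translates.\<close>
  have \<theta>: "\<theta> (k + int (2 * q)) = \<theta> k + 2 * pi * of_int (2 * (p * (k + int q)))" for k
    using q by (simp add: \<theta>_def field_simps power2_eq_square)
  have per: "cos (\<theta> (k + int (2 * q))) = cos (\<theta> k)" "sin (\<theta> (k + int (2 * q))) = sin (\<theta> k)" for k
    unfolding \<theta> cos_add sin_add by (simp_all only: cos_int_2pin sin_int_2pin mult_1_right mult_zero_right diff_zero add_0_right)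
  have even: "\<theta> (- k) = \<theta> k" for k
    by (simp add: \<theta>_def)
  have pos: "2 * q > 0" using q by simp
  have shift: "2 * pi * real j / real (2 * q) = pi * real j / real q" for j
    by simp
  obtain a :: "nat \<Rightarrow> real" where
    a: "\<And>k. (\<Sum>j<2*q. of_real (a j) * mode k (pi * real j / real q)) = of_real (cos (\<theta> k))"
    using real_dft_inversion[OF pos, of "\<lambda>k. of_real (cos (\<theta> k))"] per even shift by auto
  \<comment> \<open>The minus sign compensates that of the Hilbert multiplier: the product becomes
    \<open>\<i> * sgn k * sin (\<theta> k)\<close>.\<close>
  obtain b :: "nat \<Rightarrow> real" where
    b: "\<And>k. (\<Sum>j<2*q. of_real (b j) * mode k (pi * real j / real q)) = of_real (- sin (\<theta> k))"
    using real_dft_inversion[OF pos, of "\<lambda>k. of_real (- sin (\<theta> k))"] per even shift by auto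
  have "of_real (cos (\<theta> k)) + (- \<i> * of_int (sgn k)) * of_real (- sin (\<theta> k)) =
      cis (of_int (\<bar>k\<bar> * k) * (pi * of_int p / real q))" for k
  proof -
    \<comment> \<open>The phase is \<open>\<theta> k\<close> up to the sign of \<open>k\<close>,
      which cosine ignores and sine carries; at \<open>k = 0\<close> the phase itself
      vanishes.\<close>
    have arg: "of_int (\<bar>k\<bar> * k) * (pi * of_int p / real q) = of_int (sgn k) * \<theta> k"
      by (cases k "0 :: int" rule: linorder_cases) (auto simp: \<theta>_def power2_eq_square)
    show ?thesis
      unfolding arg by (cases k "0 :: int" rule: linorder_cases) (auto simp: complex_eq_iff \<theta>_def)
  qed
  then show thesis
    by (intro that[of a b]) (simp only: a b)
qed

section \<open>Summing the expansions of both sides\<close>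

lemma has_sum_finite_sum:
  fixes f :: "'i \<Rightarrow> 'a \<Rightarrow> 'b::topological_comm_monoid_add"
  assumes "\<And>i. i \<in> I \<Longrightarrow> (f i has_sum s i) A"
  shows "((\<lambda>k. \<Sum>i\<in>I. f i k) has_sum (\<Sum>i\<in>I. s i)) A"
  using assms by (induction I rule: infinite_finite_induct) (auto intro: has_sum_add)

lemma pdist_of_translate:
  assumes "periodic_2pi f" "periodic_2pi \<phi>"
  shows "pdist_of (\<lambda>x. f (x + h)) \<phi> = pdist_of f (\<lambda>x. \<phi> (x - h))"
proof -
  have "periodic_2pi (\<lambda>x. f x * \<phi> (x - h))"
    using assms periodic_2pi_translate[OF assms(2), of "- h"] by (simp add: periodic_2pi_def)
  from integral_periodic_shift[OF this, of h] show ?thesis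
    by (simp add: pdist_of_def)
qed

text \<open>The multiplier has modulus at most 1, so the series is dominated by that of
  \<open>T\<close>, whose summability in the complex numbers is absolute. The infinite sum in
  \<open>hilbert\<close> is therefore a genuine sum and not the default 0.\<close>

lemma hilbert_has_sum:
  assumes "periodic_distribution T" "test_function \<phi>"
  shows "((\<lambda>k. - \<i> * of_int (sgn k) * fourier_coeff T k * pdist_of (mode k) \<phi>) has_sum hilbert T \<phi>) UNIV"
proof -
  have "(\<lambda>k. fourier_coeff T k * pdist_of (mode k) \<phi>) summable_on UNIV"
    using periodic_distribution_has_sum[OF assms] by (auto simp: summable_on_def)
  then have "(\<lambda>k. norm (fourier_coeff T k * pdist_of (mode k) \<phi>)) summable_on UNIV"
    by (rule summable_on_iff_abs_summable_on_complex[THEN iffD1])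
  then have "(\<lambda>k. norm (- \<i> * of_int (sgn k) * fourier_coeff T k * pdist_of (mode k) \<phi>)) summable_on UNIV"
    by (rule Infinite_Sum.abs_summable_on_comparison_test) (auto simp: norm_mult sgn_if)
  then have "(\<lambda>k. - \<i> * of_int (sgn k) * fourier_coeff T k * pdist_of (mode k) \<phi>) summable_on UNIV"
    by (rule abs_summable_summable)
  then show ?thesis
    unfolding hilbert_def fourier_series_def mode_def[abs_def] by (rule has_sum_infsum)
qed

theorem theorem4p2:
  fixes p :: int and q :: nat
  assumes "q \<ge> 1"
  shows "\<exists>a b :: nat \<Rightarrow> real. \<forall>f :: real \<Rightarrow> complex. \<forall>u.
           periodic_2pi f \<longrightarrow> f absolutely_integrable_on {-pi..pi} \<longrightarrow> BO_solution f u \<longrightarrow>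
           pdist_eq (u (pi * real_of_int p / real q))
             (\<lambda>\<phi>. (\<Sum>j<2*q. of_real (a j) * pdist_of (\<lambda>x. f (x + pi * real j / real q)) \<phi>) +
                  (\<Sum>j<2*q. of_real (b j) *
                     pdist_translate (pi * real j / real q) (hilbert (pdist_of f)) \<phi>))"
proof -
  obtain a b :: "nat \<Rightarrow> real" where ab:
    "\<And>k. (\<Sum>j<2*q. of_real (a j) * mode k (pi * real j / real q)) +
      (- \<i> * of_int (sgn k)) * (\<Sum>j<2*q. of_real (b j) * mode k (pi * real j / real q)) =
      cis (of_int (\<bar>k\<bar> * k) * (pi * of_int p / real q))"
    using dispersion_multiplier[OF assms] by blast
  show ?thesis
  proof (rule exI[of _ a], rule exI[of _ b], intro allI impI)
    fix f :: "real \<Rightarrow> complex" and u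
    assume f: "periodic_2pi f" and int: "f absolutely_integrable_on {-pi..pi}" and u: "BO_solution f u"
    let ?t = "pi * real_of_int p / real q"
    let ?h = "\<lambda>j. pi * real j / real q"
    let ?c = "fourier_coeff (pdist_of f)"
    have pf: "periodic_distribution (pdist_of f)"
      by (rule periodic_distribution_pdist_of[OF int])
    show "pdist_eq (u ?t)
             (\<lambda>\<phi>. (\<Sum>j<2*q. of_real (a j) * pdist_of (\<lambda>x. f (x + ?h j)) \<phi>) +
                  (\<Sum>j<2*q. of_real (b j) * pdist_translate (?h j) (hilbert (pdist_of f)) \<phi>))"
      unfolding pdist_eq_def
    proof (intro allI impI)
      fix \<phi> assume \<phi>: "test_function \<phi>"
      then have per: "periodic_2pi \<phi>" by (simp add: test_function_def)
      have \<phi>h: "test_function (\<lambda>x. \<phi> (x - h))" for h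
        using test_function_translate[OF \<phi>, of "- h"] by simp
      let ?P = "\<lambda>k. pdist_of (mode k) \<phi>"
      \<comment> \<open>Moving the translation from the test function back onto the character
        produces \<open>mode k h\<close>, the multiplier of translation by \<open>h\<close>.\<close>
      have P: "pdist_of (mode k) (\<lambda>x. \<phi> (x - h)) = mode k h * ?P k" for k h
      proof -
        have "mode k (x + h) * \<phi> x = mode k h * (mode k x * \<phi> x)" for x
          by (simp add: mode_add)
        then have "pdist_of (\<lambda>x. mode k (x + h)) \<phi> = integral {-pi..pi} (\<lambda>x. mode k h * (mode k x * \<phi> x))"
          by (simp only: pdist_of_def)
        also have "\<dots> = mode k h * ?P k"
          by (simp add: pdist_of_def)
        finally show ?thesis
          unfolding pdist_of_translate[OF periodic_mode per] .
      qed
      have "((\<lambda>k. \<Sum>j<2*q. of_real (a j) * (?c k * (mode k (?h j) * ?P k))) has_sum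
          (\<Sum>j<2*q. of_real (a j) * pdist_of (\<lambda>x. f (x + ?h j)) \<phi>)) UNIV"
        using periodic_distribution_has_sum[OF pf \<phi>h]
        by (intro has_sum_finite_sum has_sum_cmult_right) (simp add: pdist_of_translate f per P)
      moreover have "((\<lambda>k. \<Sum>j<2*q. of_real (b j) * (- \<i> * of_int (sgn k) * ?c k * (mode k (?h j) * ?P k))) has_sum
          (\<Sum>j<2*q. of_real (b j) * pdist_translate (?h j) (hilbert (pdist_of f)) \<phi>)) UNIV"
        using hilbert_has_sum[OF pf \<phi>h] unfolding pdist_translate_def P
        by (intro has_sum_finite_sum has_sum_cmult_right)
      ultimately have "((\<lambda>k. (\<Sum>j<2*q. of_real (a j) * (?c k * (mode k (?h j) * ?P k))) +
            (\<Sum>j<2*q. of_real (b j) * (- \<i> * of_int (sgn k) * ?c k * (mode k (?h j) * ?P k)))) has_sum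
          (\<Sum>j<2*q. of_real (a j) * pdist_of (\<lambda>x. f (x + ?h j)) \<phi>) +
          (\<Sum>j<2*q. of_real (b j) * pdist_translate (?h j) (hilbert (pdist_of f)) \<phi>)) UNIV"
        by (rule has_sum_add)
      moreover have "(\<Sum>j<2*q. of_real (a j) * (?c k * (mode k (?h j) * ?P k))) +
            (\<Sum>j<2*q. of_real (b j) * (- \<i> * of_int (sgn k) * ?c k * (mode k (?h j) * ?P k))) =
          fourier_coeff (u ?t) k * ?P k" for k
      proof -
        \<comment> \<open>By \<open>ab\<close> the combined multiplier of all translates is the
          propagator of the \<open>k\<close>-th mode at time \<open>?t\<close>.\<close>
        have "fourier_coeff (u ?t) k * ?P k =
          ((\<Sum>j<2*q. of_real (a j) * mode k (?h j)) +
          (- \<i> * of_int (sgn k)) * (\<Sum>j<2*q. of_real (b j) * mode k (?h j))) * (?c k * ?P k)"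
          unfolding ab BO_solution_fourier_coeff[OF u] by (rule mult.assoc)
        also have "\<dots> = (\<Sum>j<2*q. of_real (a j) * mode k (?h j) * (?c k * ?P k)) +
          (\<Sum>j<2*q. - \<i> * of_int (sgn k) * (of_real (b j) * mode k (?h j)) * (?c k * ?P k))"
          by (simp only: distrib_right sum_distrib_left sum_distrib_right)
        finally show ?thesis
          by (simp only: mult_ac)
      qed
      ultimately have "((\<lambda>k. fourier_coeff (u ?t) k * ?P k) has_sum
          (\<Sum>j<2*q. of_real (a j) * pdist_of (\<lambda>x. f (x + ?h j)) \<phi>) +
          (\<Sum>j<2*q. of_real (b j) * pdist_translate (?h j) (hilbert (pdist_of f)) \<phi>)) UNIV"
        by simp
      \<comment> \<open>The solution is itself a periodic distribution, so the same series also sums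
        to its value on \<phi>; uniqueness of sums identifies the two values.\<close>
      moreover have "((\<lambda>k. fourier_coeff (u ?t) k * ?P k) has_sum u ?t \<phi>) UNIV"
        using u by (intro periodic_distribution_has_sum \<phi>) (simp add: BO_solution_def)
      ultimately show "u ?t \<phi> = (\<Sum>j<2*q. of_real (a j) * pdist_of (\<lambda>x. f (x + ?h j)) \<phi>) +
          (\<Sum>j<2*q. of_real (b j) * pdist_translate (?h j) (hilbert (pdist_of f)) \<phi>)"
        by (rule has_sum_unique[rotated])
    qed
  qed
qed

end
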